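(* Let $X$ be a locally finite tree, and let $\Gamma$ and $\Gamma'$ be commensurable lattices in $\operatorname{Aut}(X)$, both acting without edge inversions on $X$. Then the quotient graphs of groups of $\Gamma$ and $\Gamma'$ acting on $X$ have the same stabilizer growth type and also the same $p$-stabilizer growth type for each prime $p$.
   Context: $G=\operatorname{Aut}(X)$ is the locally compact group of simplicial automorphisms of $X$ (a neighborhood basis of the identity consists of the subgroups fixing larger and larger balls). A lattice in $G$ is a discrete subgroup $\Gamma$ with $\Gamma\backslash G$ of finite Haar measure. Two lattices $\Gamma_1,\Gamma_2\le G$ are commensurable (in $G$) if there exists $g\in G$ such that $g\Gamma_1g^{-1}\cap\Gamma_2$ has finite index in both $g\Gamma_1g^{-1}$ and $\Gamma_2$. For functions $f,g\colon\mathbb{N}\to\mathbb{N}$ write $f\preceq g$ if there are $\alpha,\beta\in\mathbb{N}$ with $f(k)\le\alpha\,g(k+\beta)$ for all $k$; $f$ and $g$ are equivalent if $f\preceq g$ and $g\preceq f$. The quotient graph of groups of $\Gamma$ acting on $X$ has underlying graph $A=\Gamma\backslash X$, and the vertex group at $v\in V(A)$ is the (finite) stabilizer in $\Gamma$ of a lift of $v$ to $X$. Fix a basepoint vertex $\star$ of $A$. The stabilizer growth type is the equivalence class of the function $g$ where $g(k)$ is the order of the largest vertex group at any vertex in the combinatorial ball of radius $k$ in $A$ centered at $\star$. For a prime $p$, the $p$-order $|K|_p$ of a finite group $K$ is the largest power of $p$ dividing $|K|$; the $p$-stabilizer growth type is the equivalence class of the function $g$ where $g(k)$ is the maximal $p$-order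 of any vertex group at a vertex in the combinatorial ball of radius $k$ centered at $\star$. These do not depend on the choice of $\star$. *)

theory Defs
  imports
    "HOL-Analysis.Analysis"
    "HOL-Algebra.Group_Action"
    "HOL-Computational_Algebra.Primes"
    "Graph_Theory.Graph_Theory"
begin

section \<open>Locally finite trees\<close>

text \<open>
  An undirected simple graph is a symmetric loop-free set of ordered pairs of vertices, so an
  edge together with its reverse is a closed walk of length 2 satisfying \<^const>\<open>pre_digraph.cycle\<close>.
  Acyclicity therefore excludes the longer cycles only. (The predicate \<^const>\<open>tree\<close> of Graph-Theory is about
  directed cycles and is not the notion needed here.)
\<close>

locale locally_finite_tree = pair_bidirected_digraph X for X :: "'v pair_pre_digraph" +
  assumes connected: "Digraph_Component.connected X"
    and acyclic: "cycle p \<Longrightarrow> length p \<le> 2"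
    and locally_finite: "v \<in> pverts X \<Longrightarrow> finite (out_arcs X v)"

definition graph_ball :: "('a, 'b) pre_digraph \<Rightarrow> 'a \<Rightarrow> nat \<Rightarrow> 'a set" where
  "graph_ball A x k = {y. \<exists>p. pre_digraph.awalk A x p y \<and> length p \<le> k}"


section \<open>The topological group of automorphisms\<close>

definition Aut :: "'v pair_pre_digraph \<Rightarrow> ('v \<Rightarrow> 'v) monoid" where
  "Aut X = BijGroup (pverts X)
     \<lparr>carrier := {f \<in> Bij (pverts X).
        \<forall>u \<in> pverts X. \<forall>v \<in> pverts X. (f u, f v) \<in> parcs X \<longleftrightarrow> (u, v) \<in> parcs X}\<rparr>"

definition ball_fixator :: "'v pair_pre_digraph \<Rightarrow> 'v \<Rightarrow> nat \<Rightarrow> ('v \<Rightarrow> 'v) set" where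
  "ball_fixator X x k = {g \<in> carrier (Aut X). \<forall>y \<in> graph_ball X x k. g y = y}"

definition Aut_topology :: "'v pair_pre_digraph \<Rightarrow> ('v \<Rightarrow> 'v) topology" where
  "Aut_topology X = topology_generated_by
     {g <#\<^bsub>Aut X\<^esub> ball_fixator X x k | g x k. g \<in> carrier (Aut X) \<and> x \<in> pverts X}"


section \<open>Haar measure and lattices\<close>

definition left_haar_measure ::
    "('a, 'm) monoid_scheme \<Rightarrow> 'a topology \<Rightarrow> 'a measure \<Rightarrow> bool" where
  "left_haar_measure G T M \<longleftrightarrow>
     sets M = sets (sigma (topspace T) {U. openin T U}) \<and>
     emeasure M (space M) \<noteq> 0 \<and>
     (\<forall>g \<in> carrier G. \<forall>A \<in> sets M. emeasure M (g <#\<^bsub>G\<^esub> A) = emeasure M A) \<and>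
     (\<forall>K. compactin T K \<longrightarrow> emeasure M K < \<infinity>) \<and>
     (\<forall>A \<in> sets M. emeasure M A = (INF U \<in> {U. openin T U \<and> A \<subseteq> U}. emeasure M U)) \<and>
     (\<forall>U. openin T U \<longrightarrow> emeasure M U = (SUP K \<in> {K. compactin T K \<and> K \<subseteq> U}. emeasure M K))"

text \<open>
  The coset space \<open>\<Gamma> \ G\<close> consists of the cosets \<open>\<Gamma>g\<close>, and the preimage of a set \<open>B\<close> of cosets in
  \<open>G\<close> is \<open>\<Union>B\<close>. A left Haar measure on \<open>G\<close> is invariant under the left action of the discrete
  group \<open>\<Gamma>\<close>, so it descends to the measure on \<open>\<Gamma> \ G\<close> for which the projection preserves the
  measure of every Borel set on which it is injective.
\<close>

definition quotient_haar_measure ::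
    "('a, 'm) monoid_scheme \<Rightarrow> 'a topology \<Rightarrow> 'a set \<Rightarrow> 'a set measure \<Rightarrow> bool" where
  "quotient_haar_measure G T \<Gamma> N \<longleftrightarrow>
     (\<exists>M. left_haar_measure G T M \<and>
        space N = rcosets\<^bsub>G\<^esub> \<Gamma> \<and>
        sets N = {B. B \<subseteq> rcosets\<^bsub>G\<^esub> \<Gamma> \<and> \<Union>B \<in> sets M} \<and>
        (\<forall>A \<in> sets M. inj_on (\<lambda>g. \<Gamma> #>\<^bsub>G\<^esub> g) A \<longrightarrow>
           emeasure N ((\<lambda>g. \<Gamma> #>\<^bsub>G\<^esub> g) ` A) = emeasure M A))"

definition lattice_in :: "('a, 'm) monoid_scheme \<Rightarrow> 'a topology \<Rightarrow> 'a set \<Rightarrow> bool" where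
  "lattice_in G T \<Gamma> \<longleftrightarrow>
     subgroup \<Gamma> G \<and>
     subtopology T \<Gamma> = discrete_topology \<Gamma> \<and>
     (\<exists>N. quotient_haar_measure G T \<Gamma> N \<and> emeasure N (space N) < \<infinity>)"

definition finite_index_in :: "('a, 'm) monoid_scheme \<Rightarrow> 'a set \<Rightarrow> 'a set \<Rightarrow> bool" where
  "finite_index_in G H K \<longleftrightarrow> finite (rcosets\<^bsub>G\<lparr>carrier := K\<rparr>\<^esub> H)"

definition commensurable :: "('a, 'm) monoid_scheme \<Rightarrow> 'a set \<Rightarrow> 'a set \<Rightarrow> bool" where
  "commensurable G \<Gamma>\<^sub>1 \<Gamma>\<^sub>2 \<longleftrightarrow>
     (\<exists>g \<in> carrier G.
        let C = g <#\<^bsub>G\<^esub> \<Gamma>\<^sub>1 #>\<^bsub>G\<^esub> inv\<^bsub>G\<^esub> g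
        in finite_index_in G (C \<inter> \<Gamma>\<^sub>2) C \<and> finite_index_in G (C \<inter> \<Gamma>\<^sub>2) \<Gamma>\<^sub>2)"


section \<open>Quotient graphs of groups\<close>

definition without_inversions :: "'v pair_pre_digraph \<Rightarrow> ('v \<Rightarrow> 'v) set \<Rightarrow> bool" where
  "without_inversions X \<Gamma> \<longleftrightarrow> (\<forall>g \<in> \<Gamma>. \<forall>(u, v) \<in> parcs X. \<not> (g u = v \<and> g v = u))"

text \<open>
  Vertices and arcs of the quotient graph are the orbits of \<open>\<Gamma>\<close> on the vertices and arcs of \<open>X\<close>.
  The quotient may have loops and multiple arcs. If \<open>e\<close> is the orbit of the arc \<open>(u, v)\<close>, then
  \<open>fst ` e\<close> and \<open>snd ` e\<close> are the orbits of \<open>u\<close> and of \<open>v\<close>.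
\<close>

definition quotient_graph ::
    "'v pair_pre_digraph \<Rightarrow> ('v \<Rightarrow> 'v) set \<Rightarrow> ('v set, ('v \<times> 'v) set) pre_digraph" where
  "quotient_graph X \<Gamma> =
     \<lparr>verts = orbits (Aut X\<lparr>carrier := \<Gamma>\<rparr>) (pverts X) (\<lambda>g. g),
      arcs = orbits (Aut X\<lparr>carrier := \<Gamma>\<rparr>) (parcs X) (\<lambda>g. map_prod g g),
      tail = (`) fst,
      head = (`) snd\<rparr>"

text \<open>
  The vertex group is the stabilizer of a chosen lift; another lift gives a conjugate subgroup.
\<close>

definition vertex_group :: "'v pair_pre_digraph \<Rightarrow> ('v \<Rightarrow> 'v) set \<Rightarrow> 'v set \<Rightarrow> ('v \<Rightarrow> 'v) set" where
  "vertex_group X \<Gamma> a = stabilizer (Aut X\<lparr>carrier := \<Gamma>\<rparr>) (\<lambda>g. g) (SOME x. x \<in> a)"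


section \<open>Growth types\<close>

definition growth_le :: "(nat \<Rightarrow> nat) \<Rightarrow> (nat \<Rightarrow> nat) \<Rightarrow> bool" where
  "growth_le f g \<longleftrightarrow> (\<exists>\<alpha> \<beta>. \<forall>k. f k \<le> \<alpha> * g (k + \<beta>))"

definition growth_type :: "(nat \<Rightarrow> nat) \<Rightarrow> (nat \<Rightarrow> nat) set" where
  "growth_type f = {g. growth_le f g \<and> growth_le g f}"

definition p_order :: "nat \<Rightarrow> 'a set \<Rightarrow> nat" where
  "p_order p K = p ^ multiplicity p (card K)"

definition stabilizer_growth ::
    "'v pair_pre_digraph \<Rightarrow> ('v \<Rightarrow> 'v) set \<Rightarrow> 'v set \<Rightarrow> nat \<Rightarrow> nat" where
  "stabilizer_growth X \<Gamma> a k =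
     Max ((\<lambda>b. card (vertex_group X \<Gamma> b)) ` graph_ball (quotient_graph X \<Gamma>) a k)"

definition p_stabilizer_growth ::
    "nat \<Rightarrow> 'v pair_pre_digraph \<Rightarrow> ('v \<Rightarrow> 'v) set \<Rightarrow> 'v set \<Rightarrow> nat \<Rightarrow> nat" where
  "p_stabilizer_growth p X \<Gamma> a k =
     Max ((\<lambda>b. p_order p (vertex_group X \<Gamma> b)) ` graph_ball (quotient_graph X \<Gamma>) a k)"

end

theory Submission
  imports Defs
begin

text \<open>
  Arcs of the quotient graph lift to \<open>X\<close>, so the ball of radius \<open>k\<close> around the orbit of \<open>x\<close> is the
  image of the ball around \<open>x\<close>, and the growth function is the maximum of \<open>|\<Gamma>\<^sub>y|\<close> over the latter.
  With \<open>C = g \<Gamma> g\<^sup>-\<^sup>1\<close> and \<open>\<Lambda> = C \<inter> \<Gamma>'\<close>, conjugation gives \<open>|\<Gamma>\<^sub>y| = |C\<^sub>z|\<close> for \<open>z = g y\<close>, and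
  \<open>[C\<^sub>z : \<Lambda>\<^sub>z] \<le> [C : \<Lambda>]\<close>; hence \<open>|\<Gamma>\<^sub>y| \<le> [C : \<Lambda>] |\<Gamma>'\<^sub>z|\<close>, also for \<open>p\<close>-parts, and symmetrically.
  Since \<open>X\<close> is connected, replacing \<open>g x\<close> by another centre only shifts the radius.
\<close>

section \<open>Balls in graphs\<close>

lemma (in wf_digraph) graph_ball_0: "x \<in> verts G \<Longrightarrow> graph_ball G x 0 = {x}"
  by (auto simp: graph_ball_def awalk_Nil_iff)

text \<open>Walks are split at their first arc. Inductions on the radius then let the centre vary,
  which is what lifting walks from a prescribed start vertex requires.\<close>

lemma (in wf_digraph) graph_ball_Suc:
  assumes "x \<in> verts G"
  shows "graph_ball G x (Suc k) = insert x (\<Union>e\<in>out_arcs G x. graph_ball G (head G e) k)"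
proof (intro equalityI subsetI)
  fix y assume "y \<in> graph_ball G x (Suc k)"
  then obtain p where p: "awalk x p y" "length p \<le> Suc k"
    by (auto simp: graph_ball_def)
  then show "y \<in> insert x (\<Union>e\<in>out_arcs G x. graph_ball G (head G e) k)"
    by (cases p) (auto simp: awalk_Nil_iff awalk_Cons_iff graph_ball_def)
next
  fix y assume "y \<in> insert x (\<Union>e\<in>out_arcs G x. graph_ball G (head G e) k)"
  then consider "y = x" | e p where "e \<in> arcs G" "tail G e = x" "awalk (head G e) p y" "length p \<le> k"
    by (auto simp: graph_ball_def)
  then show "y \<in> graph_ball G x (Suc k)"
  proof cases
    case 1
    then have "awalk x [] y" using assms by (simp add: awalk_Nil_iff)
    then show ?thesis unfolding graph_ball_def by force
  next
    case 2
    then have "awalk x (e # p) y" "length (e # p) \<le> Suc k" by (auto simp: awalk_Cons_iff)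
    then show ?thesis unfolding graph_ball_def by blast
  qed
qed

lemma (in wf_digraph) graph_ball_subset_verts: "graph_ball G x k \<subseteq> verts G"
  by (auto simp: graph_ball_def)

lemma (in wf_digraph) graph_ball_center: "x \<in> verts G \<Longrightarrow> x \<in> graph_ball G x k"
  by (cases k) (auto simp: graph_ball_0 graph_ball_Suc)

lemma (in wf_digraph) graph_ball_add:
  assumes "y \<in> graph_ball G x j" "z \<in> graph_ball G y k"
  shows "z \<in> graph_ball G x (j + k)"
proof -
  obtain p q where "awalk x p y" "length p \<le> j" "awalk y q z" "length q \<le> k"
    using assms by (auto simp: graph_ball_def)
  then have "awalk x (p @ q) z" "length (p @ q) \<le> j + k"
    by (auto intro: awalk_appendI simp del: awalk_append_iff)
  then show ?thesis unfolding graph_ball_def by blast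
qed

lemma (in wf_digraph) finite_graph_ball:
  assumes "\<And>v. v \<in> verts G \<Longrightarrow> finite (out_arcs G v)" "x \<in> verts G"
  shows "finite (graph_ball G x k)"
  using assms(2)
proof (induction k arbitrary: x)
  case (Suc k)
  then show ?case using assms(1) by (auto simp: graph_ball_Suc)
qed (simp add: graph_ball_0)

text \<open>Local finiteness enters here: it makes every \<open>Max\<close> over a ball a genuine
  maximum.\<close>

lemma (in locally_finite_tree) finite_ball: "x \<in> pverts X \<Longrightarrow> finite (graph_ball X x k)"
  using locally_finite by (intro finite_graph_ball) auto

lemma (in locally_finite_tree) ball_covers:
  assumes "x \<in> pverts X" "y \<in> pverts X"
  obtains k where "y \<in> graph_ball X x k"
proof -
  \<comment> \<open>Connectedness is stated for the symmetric closure, which has the same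
    reachability as \<open>X\<close> because \<open>X\<close> is bidirected.\<close>
  have "x \<rightarrow>\<^sup>*\<^bsub>mk_symmetric X\<^esub> y"
    using connected assms by (auto simp: Digraph_Component.connected_def strongly_connected_def)
  then have "x \<rightarrow>\<^sup>*\<^bsub>X\<^esub> y"
    by (simp add: reachable_mk_symmetric_eq[OF pair_sym_arcs])
  then obtain p where "awalk x p y"
    by (auto simp: reachable_awalk)
  then have "y \<in> graph_ball X x (length p)"
    by (auto simp: graph_ball_def)
  then show ?thesis by (rule that)
qed


section \<open>The automorphism group\<close>

lemma subgroup_Aut: "subgroup (carrier (Aut X)) (BijGroup (pverts X))"
proof -
  interpret group "BijGroup (pverts X)" by (rule group_BijGroup)
  have carr: "carrier (BijGroup (pverts X)) = Bij (pverts X)" by (simp add: BijGroup_def)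
  show ?thesis
  proof (rule subgroupI)
    show "carrier (Aut X) \<subseteq> carrier (BijGroup (pverts X))"
      by (auto simp: Aut_def carr)
    have "(\<lambda>x\<in>pverts X. x) \<in> carrier (Aut X)"
      by (simp add: Aut_def id_Bij)
    then show "carrier (Aut X) \<noteq> {}" by blast
  next
    fix f assume f: "f \<in> carrier (Aut X)"
    then have B: "f \<in> Bij (pverts X)" by (simp add: Aut_def)
    then have bij: "bij_betw f (pverts X) (pverts X)" by (simp add: Bij_def)
    have "inv\<^bsub>BijGroup (pverts X)\<^esub> f = (\<lambda>x\<in>pverts X. inv_into (pverts X) f x)"
      using B by (simp add: inv_BijGroup)
    \<comment> \<open>The arc condition in \<open>Aut\<close> is an equivalence, so applying it for
      \<open>f\<close> to the two preimages settles the inverse.\<close>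
    moreover have "(inv_into (pverts X) f u, inv_into (pverts X) f v) \<in> parcs X \<longleftrightarrow> (u, v) \<in> parcs X"
      if "u \<in> pverts X" "v \<in> pverts X" for u v
    proof -
      have "inv_into (pverts X) f u \<in> pverts X" "inv_into (pverts X) f v \<in> pverts X"
        using that Bij_inv_into_mem[OF B] by auto
      then show ?thesis
        using f that bij bij_betw_inv_into_right[OF bij] by (force simp: Aut_def)
    qed
    ultimately show "inv\<^bsub>BijGroup (pverts X)\<^esub> f \<in> carrier (Aut X)"
      using restrict_inv_into_Bij[OF B] by (simp add: Aut_def)
  next
    fix f g assume "f \<in> carrier (Aut X)" "g \<in> carrier (Aut X)"
    then show "f \<otimes>\<^bsub>BijGroup (pverts X)\<^esub> g \<in> carrier (Aut X)"
      by (auto simp: Aut_def BijGroup_def compose_Bij compose_eq Bij_imp_funcset[THEN funcset_mem])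
  qed
qed

text \<open>This is the carrier update of \<open>BijGroup\<close> in which
  \<open>subgroup_imp_group\<close> delivers its result.\<close>

lemma Aut_eq: "Aut X = BijGroup (pverts X)\<lparr>carrier := carrier (Aut X)\<rparr>"
  by (simp add: Aut_def)

lemma group_Aut: "group (Aut X)"
  using group.subgroup_imp_group[OF group_BijGroup subgroup_Aut] by (simp flip: Aut_eq)

text \<open>The action homomorphism is the inclusion of \<open>Aut X\<close> into
  \<open>BijGroup (pverts X)\<close>.\<close>

lemma group_action_Aut: "group_action (Aut X) (pverts X) (\<lambda>g. g)"
proof -
  have "carrier (Aut X) \<subseteq> carrier (BijGroup (pverts X))"
    using subgroup.subset[OF subgroup_Aut] .
  moreover have "mult (Aut X) = mult (BijGroup (pverts X))"
    by (simp add: Aut_def)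
  ultimately show ?thesis
    by (simp add: group_action_def group_hom_def group_hom_axioms_def group_Aut group_BijGroup hom_def Pi_def subset_iff)
qed

lemma Aut_closed: "\<lbrakk>g \<in> carrier (Aut X); x \<in> pverts X\<rbrakk> \<Longrightarrow> g x \<in> pverts X"
  by (auto simp: Aut_def dest: Bij_imp_funcset)

lemma Aut_mult: "\<lbrakk>g \<in> carrier (Aut X); h \<in> carrier (Aut X); x \<in> pverts X\<rbrakk>
    \<Longrightarrow> (g \<otimes>\<^bsub>Aut X\<^esub> h) x = g (h x)"
  by (auto simp: Aut_def BijGroup_def compose_eq)

lemma Aut_inv: "\<lbrakk>g \<in> carrier (Aut X); x \<in> pverts X\<rbrakk> \<Longrightarrow> (inv\<^bsub>Aut X\<^esub> g) (g x) = x"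
  using group_action.orbit_sym_aux[OF group_action_Aut] by metis

lemma Aut_inv': "\<lbrakk>g \<in> carrier (Aut X); x \<in> pverts X\<rbrakk> \<Longrightarrow> g ((inv\<^bsub>Aut X\<^esub> g) x) = x"
  by (metis Aut_inv group.inv_closed group.inv_inv group_Aut)

lemma (in pair_wf_digraph) Aut_arc:
  assumes "g \<in> carrier (Aut G)" "(u, v) \<in> parcs G"
  shows "(g u, g v) \<in> parcs G"
  using assms in_arcsD1 in_arcsD2 by (auto simp: Aut_def)

lemma (in pair_wf_digraph) Aut_ball:
  assumes "g \<in> carrier (Aut G)" "x \<in> pverts G" "y \<in> graph_ball G x k"
  shows "g y \<in> graph_ball G (g x) k"
  using assms(2,3)
proof (induction k arbitrary: x)
  case 0
  then show ?case using Aut_closed[OF assms(1)] graph_ball_0 by auto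
next
  case (Suc k)
  then consider "y = x" | v where "(x, v) \<in> parcs G" "y \<in> graph_ball G v k"
    by (auto simp: graph_ball_Suc out_arcs_def)
  then show ?case
  proof cases
    case 1
    then show ?thesis using Aut_closed[OF assms(1)] graph_ball_center Suc by auto
  next
    case 2
    then have "(g x, g v) \<in> parcs G" "g y \<in> graph_ball G (g v) k"
      using Suc.IH Aut_arc[OF assms(1)] in_arcsD2 by auto
    then show ?thesis
      using Aut_closed[OF assms(1)] Suc.prems(1) by (force simp: graph_ball_Suc out_arcs_def)
  qed
qed


section \<open>Stabilizers in commensurable subgroups\<close>

text \<open>A coset of \<open>H \<inter> K\<close> in \<open>K\<close> is recovered from the coset
  of \<open>H\<close> with the same representative by intersecting with \<open>K\<close>. Hence the
  index of \<open>H \<inter> K\<close> in \<open>K\<close> is at most that of \<open>H\<close> when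
  the latter is finite.\<close>

lemma (in group) rcosets_Int_subset:
  assumes H: "subgroup H G" and K: "subgroup K G"
  shows "rcosets\<^bsub>G\<lparr>carrier := K\<rparr>\<^esub> (H \<inter> K) \<subseteq> (\<lambda>R. R \<inter> K) ` (rcosets H)"
proof
  fix C assume "C \<in> rcosets\<^bsub>G\<lparr>carrier := K\<rparr>\<^esub> (H \<inter> K)"
  then obtain k where k: "k \<in> K" and C: "C = (\<lambda>h. h \<otimes> k) ` (H \<inter> K)"
    by (auto simp: RCOSETS_def r_coset_def)
  have kG: "k \<in> carrier G" using k K subgroup.mem_carrier by metis
  have "(H #> k) \<inter> K = C"
  proof (intro equalityI subsetI)
    fix c assume "c \<in> (H #> k) \<inter> K"
    then obtain h where h: "h \<in> H" "c = h \<otimes> k" "h \<otimes> k \<in> K" by (auto simp: r_coset_def)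
    have "h \<in> carrier G" using h H subgroup.mem_carrier by metis
    \<comment> \<open>Both \<open>h \<otimes> k\<close> and \<open>k\<close> lie in
      \<open>K\<close>, hence so does \<open>h\<close>.\<close>
    then have "h = (h \<otimes> k) \<otimes> inv k" using kG by (simp add: m_assoc)
    also have "\<dots> \<in> K" using K h k by (meson subgroup.m_closed subgroup.m_inv_closed)
    finally show "c \<in> C" using h C by auto
  next
    fix c assume "c \<in> C"
    then show "c \<in> (H #> k) \<inter> K"
      using C k K by (auto simp: r_coset_def subgroup.m_closed)
  qed
  moreover have "H #> k \<in> rcosets H" using kG by (auto simp: RCOSETS_def)
  ultimately show "C \<in> (\<lambda>R. R \<inter> K) ` (rcosets H)" by blast
qed

text \<open>The factor \<open>j\<close> is the index of \<open>K \<inter> S\<close> in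
  \<open>H \<inter> S\<close>, bounded by applying \<open>rcosets_Int_subset\<close> inside the
  group \<open>H\<close>. In the application \<open>S\<close> is the stabilizer of a vertex in
  \<open>Aut X\<close>.\<close>

lemma (in group) card_Int_eq_index_mult:
  assumes H: "subgroup H G" and K: "subgroup K G" and S: "subgroup S G" and "K \<subseteq> H"
    and fin: "finite_index_in G K H"
  obtains j where "0 < j" "j \<le> card (rcosets\<^bsub>G\<lparr>carrier := H\<rparr>\<^esub> K)"
    "card (H \<inter> S) = j * card (K \<inter> S)"
proof -
  interpret H: group "G\<lparr>carrier := H\<rparr>" by (rule subgroup_imp_group[OF H])
  have HS: "subgroup (H \<inter> S) G" using H S by (rule subgroups_Inter_pair)
  have HS_H: "subgroup (H \<inter> S) (G\<lparr>carrier := H\<rparr>)" by (rule subgroup_incl[OF HS H]) simp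
  have K_H: "subgroup K (G\<lparr>carrier := H\<rparr>)" by (rule subgroup_incl[OF K H \<open>K \<subseteq> H\<close>])
  have KS: "K \<inter> (H \<inter> S) = K \<inter> S" using \<open>K \<subseteq> H\<close> by blast
  interpret HS: group "G\<lparr>carrier := H \<inter> S\<rparr>" by (rule subgroup_imp_group[OF HS])
  let ?R = "rcosets\<^bsub>G\<lparr>carrier := H \<inter> S\<rparr>\<^esub> (K \<inter> S)"
  let ?Q = "rcosets\<^bsub>G\<lparr>carrier := H\<rparr>\<^esub> K"
  have finQ: "finite ?Q" using fin by (simp add: finite_index_in_def)
  have sub: "?R \<subseteq> (\<lambda>R. R \<inter> (H \<inter> S)) ` ?Q"
    using H.rcosets_Int_subset[OF K_H HS_H] by (simp add: KS)
  have "finite ?R" using finQ sub by (meson finite_imageI finite_subset)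
  moreover have "?R \<noteq> {}" using HS.one_closed by (auto simp: RCOSETS_def)
  \<comment> \<open>Since \<open>card\<close> is 0 on infinite sets, positivity rests on finiteness
    as well as on the existence of a coset.\<close>
  ultimately have "0 < card ?R" by (simp add: card_gt_0_iff)
  moreover have "card ?R \<le> card ?Q" by (rule surj_card_le[OF finQ sub])
  moreover have "subgroup (K \<inter> S) (G\<lparr>carrier := H \<inter> S\<rparr>)"
    using subgroup_incl[OF subgroups_Inter_pair[OF K S] HS] \<open>K \<subseteq> H\<close> by blast
  from HS.lagrange[OF this] have "card (H \<inter> S) = card ?R * card (K \<inter> S)"
    by (simp add: order_def)
  ultimately show ?thesis by (rule that)
qed

text \<open>Stabilizers in different subgroups become intersections with one common group, the form
  that \<open>card_Int_eq_index_mult\<close> handles.\<close>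

lemma stabilizer_restrict:
  "H \<subseteq> carrier G \<Longrightarrow> stabilizer (G\<lparr>carrier := H\<rparr>) \<phi> x = H \<inter> stabilizer G \<phi> x"
  by (auto simp: stabilizer_def)

text \<open>Right translation by \<open>h\<close> permutes \<open>H\<close>. Assuming just the
  equation \<open>eq\<close> about \<open>\<phi>\<close> covers vertices and arcs at once, without
  setting up a separate action on arcs.\<close>

lemma (in group) orbit_translate:
  assumes H: "subgroup H G" and h: "h \<in> H" and eq: "\<And>g. g \<in> H \<Longrightarrow> \<phi> g y = \<phi> (g \<otimes> h) x"
  shows "Group_Action.orbit (G\<lparr>carrier := H\<rparr>) \<phi> y = Group_Action.orbit (G\<lparr>carrier := H\<rparr>) \<phi> x"
proof -
  have "\<phi> (g \<otimes> h) x \<in> (\<lambda>g. \<phi> g x) ` H" if "g \<in> H" for g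
    using subgroup.m_closed[OF H that h] by blast
  moreover have "\<phi> g x \<in> (\<lambda>g. \<phi> (g \<otimes> h) x) ` H" if "g \<in> H" for g
  proof -
    have "g \<in> carrier G" "h \<in> carrier G" using that h H subgroup.mem_carrier by metis+
    then have "g = (g \<otimes> inv h) \<otimes> h" by (simp add: m_assoc)
    moreover have "g \<otimes> inv h \<in> H" using H h that by (meson subgroup.m_closed subgroup.m_inv_closed)
    ultimately show ?thesis by (metis image_eqI)
  qed
  ultimately show ?thesis
    using eq by (auto simp: Group_Action.orbit_def image_iff) metis+
qed

section \<open>Conjugate subgroups and their stabilizers\<close>

abbreviation (in group) conjugate :: "'a \<Rightarrow> 'a set \<Rightarrow> 'a set" where
  "conjugate g H \<equiv> g <# H #> inv g"

lemma (in group) conjugate_eq_image: "conjugate g H = (\<lambda>h. g \<otimes> h \<otimes> inv g) ` H"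
  by (auto simp: l_coset_def r_coset_def)

lemma (in group) conjugate_conjugate_inv:
  assumes "g \<in> carrier G" "H \<subseteq> carrier G"
  shows "conjugate (inv g) (conjugate g H) = H"
proof -
  have "inv g \<otimes> (g \<otimes> h \<otimes> inv g) \<otimes> inv (inv g) = h" if "h \<in> H" for h
    using that assms by (simp add: m_assoc subset_iff) (simp flip: m_assoc)
  then show ?thesis by (simp add: conjugate_eq_image image_image)
qed

lemma (in group) subgroup_conjugate:
  assumes g: "g \<in> carrier G" and H: "subgroup H G"
  shows "subgroup (conjugate g H) G"
proof (rule subgroupI)
  have mem: "h \<in> carrier G" if "h \<in> H" for h using that H subgroup.mem_carrier by metis
  show "conjugate g H \<subseteq> carrier G" "conjugate g H \<noteq> {}"
    using g mem subgroup.one_closed[OF H] by (auto simp: conjugate_eq_image)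
  show "inv a \<in> conjugate g H" if "a \<in> conjugate g H" for a
  proof -
    obtain h where h: "h \<in> H" "a = g \<otimes> h \<otimes> inv g" using \<open>a \<in> _\<close> by (auto simp: conjugate_eq_image)
    have "inv a = g \<otimes> inv h \<otimes> inv g" using g h mem by (simp add: inv_mult_group m_assoc)
    then show ?thesis using subgroup.m_inv_closed[OF H h(1)] by (auto simp: conjugate_eq_image)
  qed
  show "a \<otimes> b \<in> conjugate g H" if ab: "a \<in> conjugate g H" "b \<in> conjugate g H" for a b
  proof -
    obtain h h' where h: "h \<in> H" "a = g \<otimes> h \<otimes> inv g" "h' \<in> H" "b = g \<otimes> h' \<otimes> inv g"
      using ab by (auto simp: conjugate_eq_image)
    have "inv g \<otimes> (g \<otimes> (h' \<otimes> inv g)) = h' \<otimes> inv g"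
      using g h mem by (simp flip: m_assoc)
    then have "a \<otimes> b = g \<otimes> (h \<otimes> h') \<otimes> inv g" using g h mem by (simp add: m_assoc)
    then show ?thesis using subgroup.m_closed[OF H h(1) h(3)] by (auto simp: conjugate_eq_image)
  qed
qed

text \<open>Closure of \<open>H\<close> gives one inclusion for every element of \<open>H\<close>.
  The other is the same inclusion for \<open>inv g\<close>, conjugated back by
  \<open>g\<close>.\<close>

lemma (in group) conjugate_subgroup_self:
  assumes H: "subgroup H G" and "g \<in> H"
  shows "conjugate g H = H"
proof -
  have sub: "conjugate g H \<subseteq> H" if "g \<in> H" for g
    using that H by (auto simp: conjugate_eq_image subgroup.m_closed subgroup.m_inv_closed)
  have "inv g \<in> H" "g \<in> carrier G" "H \<subseteq> carrier G"
    using assms by (auto intro: subgroup.m_inv_closed subgroup.mem_carrier)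
  then have "H = conjugate g (conjugate (inv g) H)"
    using conjugate_conjugate_inv[of "inv g" H] by simp
  also have "\<dots> \<subseteq> conjugate g H"
    using sub[OF \<open>inv g \<in> H\<close>] unfolding conjugate_eq_image by (rule image_mono)
  finally show ?thesis using sub[OF \<open>g \<in> H\<close>] by blast
qed

text \<open>Conjugation by \<open>g\<close> maps one stabilizer bijectively onto the other. For
  \<open>g\<close> in a subgroup \<open>H\<close> this compares two lifts of a vertex of the
  quotient; for the commensurating \<open>g\<close> it compares \<open>\<Gamma>\<close> with its
  conjugate.\<close>

lemma (in group_action) card_stabilizer_conjugate:
  assumes g: "g \<in> carrier G" and H: "H \<subseteq> carrier G" and x: "x \<in> E"
  shows "card (stabilizer (G\<lparr>carrier := g <#\<^bsub>G\<^esub> H #>\<^bsub>G\<^esub> inv\<^bsub>G\<^esub> g\<rparr>) \<phi> (\<phi> g x)) =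
    card (stabilizer (G\<lparr>carrier := H\<rparr>) \<phi> x)"
proof -
  interpret G: group G using group_hom by (simp add: group_hom_def)
  let ?c = "\<lambda>h. g \<otimes>\<^bsub>G\<^esub> h \<otimes>\<^bsub>G\<^esub> inv\<^bsub>G\<^esub> g"
  have fix_iff: "\<phi> (?c h) (\<phi> g x) = \<phi> g x \<longleftrightarrow> \<phi> h x = x" if "h \<in> H" for h
  proof -
    have h: "h \<in> carrier G" using that H by blast
    have "\<phi> (?c h) (\<phi> g x) = \<phi> (g \<otimes>\<^bsub>G\<^esub> h) (\<phi> (inv\<^bsub>G\<^esub> g) (\<phi> g x))"
      using g h by (intro composition_rule element_image[OF g x refl]) simp_all
    also have "\<dots> = \<phi> g (\<phi> h x)"
      using orbit_sym_aux[OF g x refl] composition_rule[OF x g h] by simp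
    \<comment> \<open>Injectivity of \<open>\<phi> g\<close> cancels \<open>g\<close> from the
      equation between \<open>\<phi> g (\<phi> h x)\<close> and \<open>\<phi> g x\<close>.\<close>
    finally show ?thesis
      using inj_prop[OF g] x element_image[OF h x refl] by (auto simp: inj_on_eq_iff)
  qed
  have "stabilizer (G\<lparr>carrier := G.conjugate g H\<rparr>) \<phi> (\<phi> g x) =
      ?c ` stabilizer (G\<lparr>carrier := H\<rparr>) \<phi> x"
    using fix_iff by (auto simp: stabilizer_def G.conjugate_eq_image)
  moreover have "inj_on ?c (stabilizer (G\<lparr>carrier := H\<rparr>) \<phi> x)"
    using g H by (auto simp: inj_on_def stabilizer_def subset_iff)
  ultimately show ?thesis by (simp add: card_image)
qed


section \<open>Growth functions of quotient graphs of groups\<close>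

locale aut_subgroup = pair_wf_digraph X for X :: "'v pair_pre_digraph" +
  fixes \<Gamma> :: "('v \<Rightarrow> 'v) set"
  assumes subgroup: "subgroup \<Gamma> (Aut X)"
begin

abbreviation vertex_orbit :: "'v \<Rightarrow> 'v set" where
  "vertex_orbit x \<equiv> Group_Action.orbit (Aut X\<lparr>carrier := \<Gamma>\<rparr>) (\<lambda>g. g) x"

abbreviation arc_orbit :: "'v \<times> 'v \<Rightarrow> ('v \<times> 'v) set" where
  "arc_orbit e \<equiv> Group_Action.orbit (Aut X\<lparr>carrier := \<Gamma>\<rparr>) (\<lambda>g. map_prod g g) e"

abbreviation stab :: "'v \<Rightarrow> ('v \<Rightarrow> 'v) set" where
  "stab x \<equiv> stabilizer (Aut X\<lparr>carrier := \<Gamma>\<rparr>) (\<lambda>g. g) x"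

lemma mem_Aut: "h \<in> \<Gamma> \<Longrightarrow> h \<in> carrier (Aut X)"
  using subgroup subgroup.mem_carrier by metis

lemma vertex_orbit_translate:
  assumes "h \<in> \<Gamma>" "x \<in> pverts X"
  shows "vertex_orbit (h x) = vertex_orbit x"
  by (rule group.orbit_translate[OF group_Aut subgroup assms(1)]) (simp add: assms mem_Aut Aut_mult)

lemma self_mem_vertex_orbit: "x \<in> pverts X \<Longrightarrow> x \<in> vertex_orbit x"
proof -
  assume "x \<in> pverts X"
  moreover have "\<one>\<^bsub>Aut X\<^esub> = (\<lambda>x\<in>pverts X. x)" by (simp add: Aut_def BijGroup_def)
  moreover have "\<one>\<^bsub>Aut X\<^esub> \<in> \<Gamma>" using subgroup subgroup.one_closed by blast
  ultimately show ?thesis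
    unfolding Group_Action.orbit_def by (auto intro!: exI[of _ "\<one>\<^bsub>Aut X\<^esub>"])
qed

lemma arc_orbit_translate:
  assumes "h \<in> \<Gamma>" "(u, v) \<in> parcs X"
  shows "arc_orbit (h u, h v) = arc_orbit (u, v)"
  by (rule group.orbit_translate[OF group_Aut subgroup assms(1)])
    (use assms in_arcsD1 in_arcsD2 in \<open>simp add: mem_Aut Aut_mult\<close>)

text \<open>With its counterpart for \<open>snd\<close> this shows that ends of arc orbits are
  vertex orbits, independently of the representative.\<close>

lemma fst_arc_orbit: "fst ` arc_orbit (u, v) = vertex_orbit u"
  by (force simp: Group_Action.orbit_def image_iff)

lemma snd_arc_orbit: "snd ` arc_orbit (u, v) = vertex_orbit v"
  by (force simp: Group_Action.orbit_def image_iff)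

lemma quotient_graph_simps:
  "verts (quotient_graph X \<Gamma>) = vertex_orbit ` pverts X"
  "arcs (quotient_graph X \<Gamma>) = arc_orbit ` parcs X"
  "tail (quotient_graph X \<Gamma>) e = fst ` e"
  "head (quotient_graph X \<Gamma>) e = snd ` e"
  by (auto simp: quotient_graph_def orbits_def)

lemma wf_quotient_graph: "wf_digraph (quotient_graph X \<Gamma>)"
  by unfold_locales (auto simp: quotient_graph_simps fst_arc_orbit snd_arc_orbit in_arcsD1 in_arcsD2)

text \<open>An arc of the quotient starting at the orbit of \<open>x\<close> lifts to an arc of \<open>X\<close> starting at \<open>x\<close>.\<close>

lemma heads_quotient_graph:
  assumes x: "x \<in> pverts X"
  shows "head (quotient_graph X \<Gamma>) ` out_arcs (quotient_graph X \<Gamma>) (vertex_orbit x) =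
    vertex_orbit ` snd ` out_arcs X x"
proof (intro equalityI subsetI)
  fix b assume "b \<in> head (quotient_graph X \<Gamma>) ` out_arcs (quotient_graph X \<Gamma>) (vertex_orbit x)"
  then obtain u v where uv: "(u, v) \<in> parcs X" "vertex_orbit u = vertex_orbit x" "b = vertex_orbit v"
    by (auto simp: out_arcs_def quotient_graph_simps fst_arc_orbit snd_arc_orbit)
  \<comment> \<open>The lift \<open>(u, v)\<close> starts somewhere in the orbit of
    \<open>x\<close>; an \<open>h \<in> \<Gamma>\<close> with \<open>h u = x\<close> moves it to
    \<open>x\<close> and keeps the orbit of its head.\<close>
  then have "x \<in> vertex_orbit u" using self_mem_vertex_orbit[OF x] by simp
  then obtain h where h: "h \<in> \<Gamma>" "x = h u" by (auto simp: Group_Action.orbit_def)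
  then have "(x, h v) \<in> out_arcs X x"
    using Aut_arc[OF mem_Aut uv(1)] by (simp add: out_arcs_def)
  moreover have "b = vertex_orbit (h v)"
    using vertex_orbit_translate[OF h(1)] in_arcsD2[OF uv(1)] uv(3) by simp
  ultimately show "b \<in> vertex_orbit ` snd ` out_arcs X x" by (metis image_eqI snd_conv)
next
  fix b assume "b \<in> vertex_orbit ` snd ` out_arcs X x"
  then obtain v where v: "(x, v) \<in> parcs X" "b = vertex_orbit v" by (auto simp: out_arcs_def)
  then have "arc_orbit (x, v) \<in> out_arcs (quotient_graph X \<Gamma>) (vertex_orbit x)"
    by (simp add: out_arcs_def quotient_graph_simps fst_arc_orbit)
  moreover have "b = head (quotient_graph X \<Gamma>) (arc_orbit (x, v))"
    using v by (simp add: quotient_graph_simps snd_arc_orbit)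
  ultimately show "b \<in> head (quotient_graph X \<Gamma>) ` out_arcs (quotient_graph X \<Gamma>) (vertex_orbit x)"
    by blast
qed

text \<open>The first arc is lifted by \<open>heads_quotient_graph\<close>, and the induction
  hypothesis is applied at the head of the lift, whence the arbitrary centre.\<close>

lemma graph_ball_quotient_graph:
  assumes "x \<in> pverts X"
  shows "graph_ball (quotient_graph X \<Gamma>) (vertex_orbit x) k = vertex_orbit ` graph_ball X x k"
  using assms
proof (induction k arbitrary: x)
  case 0
  then show ?case
    using wf_digraph.graph_ball_0[OF wf_quotient_graph] graph_ball_0[of x]
    by (simp add: quotient_graph_simps)
next
  case (Suc k)
  have "graph_ball (quotient_graph X \<Gamma>) (vertex_orbit x) (Suc k) = insert (vertex_orbit x)
      (\<Union>b\<in>head (quotient_graph X \<Gamma>) ` out_arcs (quotient_graph X \<Gamma>) (vertex_orbit x).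
        graph_ball (quotient_graph X \<Gamma>) b k)"
    using wf_digraph.graph_ball_Suc[OF wf_quotient_graph] Suc.prems
    by (simp add: quotient_graph_simps)
  also have "\<dots> = insert (vertex_orbit x)
      (\<Union>e\<in>out_arcs X x. graph_ball (quotient_graph X \<Gamma>) (vertex_orbit (snd e)) k)"
    by (simp add: heads_quotient_graph[OF Suc.prems])
  also have "\<dots> = insert (vertex_orbit x) (\<Union>e\<in>out_arcs X x. vertex_orbit ` graph_ball X (snd e) k)"
    using Suc.IH arc_snd_in_verts by (simp add: out_arcs_def)
  also have "\<dots> = vertex_orbit ` graph_ball X x (Suc k)"
    using graph_ball_Suc[of x k] Suc.prems by (simp add: image_UN)
  finally show ?case .
qed

text \<open>The lift picked by \<open>SOME\<close> is \<open>h x\<close> for some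
  \<open>h \<in> \<Gamma>\<close>, and conjugation by \<open>h\<close> preserves
  \<open>\<Gamma>\<close>, so the chosen lift does not affect the order.\<close>

lemma card_vertex_group:
  assumes x: "x \<in> pverts X"
  shows "card (vertex_group X \<Gamma> (vertex_orbit x)) = card (stab x)"
proof -
  have "(SOME y. y \<in> vertex_orbit x) \<in> vertex_orbit x"
    using self_mem_vertex_orbit[OF x] by (rule someI)
  then obtain h where h: "h \<in> \<Gamma>" "(SOME y. y \<in> vertex_orbit x) = h x"
    unfolding Group_Action.orbit_def by auto
  have "card (stab (h x)) = card (stab x)"
    using group_action.card_stabilizer_conjugate[OF group_action_Aut mem_Aut[OF h(1)]
        subgroup.subset[OF subgroup] x]
    unfolding group.conjugate_subgroup_self[OF group_Aut subgroup h(1)] .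
  then show ?thesis
    unfolding vertex_group_def h(2) .
qed

lemma growth_eq_ball:
  assumes "x \<in> pverts X"
  shows "(\<lambda>b. w (card (vertex_group X \<Gamma> b))) ` graph_ball (quotient_graph X \<Gamma>) (vertex_orbit x) k =
    (\<lambda>y. w (card (stab y))) ` graph_ball X x k"
proof -
  have "y \<in> pverts X" if "y \<in> graph_ball X x k" for y
    using that graph_ball_subset_verts by auto
  then show ?thesis
    unfolding graph_ball_quotient_graph[OF assms] image_image
    by (intro image_cong refl) (simp add: card_vertex_group)
qed

end

section \<open>Comparison of growth functions\<close>

lemma growth_le_trans: "\<lbrakk>growth_le f g; growth_le g h\<rbrakk> \<Longrightarrow> growth_le f h"
proof -
  assume "growth_le f g" "growth_le g h"
  then obtain a b c d where f: "\<And>k. f k \<le> a * g (k + b)" and g: "\<And>k. g k \<le> c * h (k + d)"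
    unfolding growth_le_def by blast
  have "f k \<le> (a * c) * h (k + (b + d))" for k
    using order_trans[OF f[of k] mult_le_mono2[OF g[of "k + b"]]] by (simp add: ac_simps)
  then show ?thesis by (auto simp: growth_le_def)
qed

lemma growth_type_eqI: "\<lbrakk>growth_le f g; growth_le g f\<rbrakk> \<Longrightarrow> growth_type f = growth_type g"
  by (auto simp: growth_type_def intro: growth_le_trans)

text \<open>If \<open>g x\<close> is within distance \<open>b\<close> of \<open>y\<close>, then
  \<open>g\<close> carries the ball of radius \<open>k\<close> around \<open>x\<close> into the ball
  of radius \<open>k + b\<close> around \<open>y\<close>. So \<open>m\<close> and \<open>b\<close>
  serve as the two constants of \<open>growth_le\<close>.\<close>

lemma (in locally_finite_tree) growth_le_translate:
  fixes u w :: "'v \<Rightarrow> nat"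
  assumes g: "g \<in> carrier (Aut X)" and x: "x \<in> pverts X" and y: "y \<in> pverts X"
    and le: "\<And>z. z \<in> pverts X \<Longrightarrow> u z \<le> m * w (g z)"
  shows "growth_le (\<lambda>k. Max (u ` graph_ball X x k)) (\<lambda>k. Max (w ` graph_ball X y k))"
proof -
  obtain b where b: "g x \<in> graph_ball X y b" using ball_covers[OF y Aut_closed[OF g x]] .
  have "Max (u ` graph_ball X x k) \<le> m * Max (w ` graph_ball X y (k + b))" for k
  proof (rule Max.boundedI)
    show "finite (u ` graph_ball X x k)" using finite_ball[OF x] by simp
    show "u ` graph_ball X x k \<noteq> {}" using graph_ball_center[of x] x by auto
    fix n assume "n \<in> u ` graph_ball X x k"
    then obtain z where z: "z \<in> graph_ball X x k" "n = u z" by blast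
    have "g z \<in> graph_ball X y (b + k)" using graph_ball_add[OF b Aut_ball[OF g x z(1)]] .
    then have "w (g z) \<le> Max (w ` graph_ball X y (k + b))"
      using finite_ball[OF y] by (intro Max_ge) (auto simp: add.commute)
    moreover have "u z \<le> m * w (g z)" using le z graph_ball_subset_verts by auto
    ultimately show "n \<le> m * Max (w ` graph_ball X y (k + b))"
      using z(2) by (meson le_trans mult_le_mono2)
  qed
  then show ?thesis by (auto simp: growth_le_def)
qed

text \<open>
  The function \<open>w\<close> stands for the identity or the \<open>p\<close>-part. Infinite stabilizers would have \<^const>\<open>card\<close> 0
  and \<open>p\<close>-part 1, and Lagrange's theorem \<open>card H = j * card K\<close> remains true for them.
\<close>

lemma growth_type_commensurable:
  fixes w :: "nat \<Rightarrow> nat"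
  assumes tree: "locally_finite_tree X"
    and sub: "subgroup \<Gamma> (Aut X)" "subgroup \<Gamma>' (Aut X)"
    and comm: "commensurable (Aut X) \<Gamma> \<Gamma>'"
    and a: "a \<in> verts (quotient_graph X \<Gamma>)" and a': "a' \<in> verts (quotient_graph X \<Gamma>')"
    and w_mono: "\<And>j n. 0 < j \<Longrightarrow> w n \<le> w (j * n)"
    and w_mult: "\<And>j n. 0 < j \<Longrightarrow> w (j * n) \<le> j * w n"
  shows "growth_type (\<lambda>k. Max ((\<lambda>b. w (card (vertex_group X \<Gamma> b))) ` graph_ball (quotient_graph X \<Gamma>) a k)) =
    growth_type (\<lambda>k. Max ((\<lambda>b. w (card (vertex_group X \<Gamma>' b))) ` graph_ball (quotient_graph X \<Gamma>') a' k))"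
proof -
  interpret locally_finite_tree X by (rule tree)
  interpret A: group "Aut X" by (rule group_Aut)
  interpret act: group_action "Aut X" "pverts X" "\<lambda>g. g" by (rule group_action_Aut)
  interpret \<Gamma>: aut_subgroup X \<Gamma>
    by (intro aut_subgroup.intro aut_subgroup_axioms.intro pair_wf_digraph_axioms sub)
  interpret \<Gamma>': aut_subgroup X \<Gamma>'
    by (intro aut_subgroup.intro aut_subgroup_axioms.intro pair_wf_digraph_axioms sub)
  obtain x where x: "x \<in> pverts X" "a = \<Gamma>.vertex_orbit x"
    using a \<Gamma>.quotient_graph_simps(1) by auto
  obtain y where y: "y \<in> pverts X" "a' = \<Gamma>'.vertex_orbit y"
    using a' \<Gamma>'.quotient_graph_simps(1) by auto
  obtain g where g: "g \<in> carrier (Aut X)"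
    and fin: "finite_index_in (Aut X) (A.conjugate g \<Gamma> \<inter> \<Gamma>') (A.conjugate g \<Gamma>)"
      "finite_index_in (Aut X) (A.conjugate g \<Gamma> \<inter> \<Gamma>') \<Gamma>'"
    using comm by (auto simp: commensurable_def Let_def)
  define C where "C = A.conjugate g \<Gamma>"
  have C: "subgroup C (Aut X)" unfolding C_def by (rule A.subgroup_conjugate[OF g sub(1)])
  have CG: "subgroup (C \<inter> \<Gamma>') (Aut X)" by (rule A.subgroups_Inter_pair[OF C sub(2)])
  \<comment> \<open>Passing from \<open>H \<inter> S\<close> down to the common subgroup
    \<open>C \<inter> \<Gamma>' \<inter> S\<close> costs at most the index, and passing up to
    \<open>K \<inter> S\<close> costs nothing. Stating this for general \<open>H\<close> and
    \<open>K\<close> gives both directions, with \<open>C\<close> and \<open>\<Gamma>'\<close>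
    exchanged.\<close>
  have w_le: "w (card (H \<inter> S)) \<le> card (rcosets\<^bsub>Aut X\<lparr>carrier := H\<rparr>\<^esub> (C \<inter> \<Gamma>')) * w (card (K \<inter> S))"
    if HKS: "subgroup H (Aut X)" "finite_index_in (Aut X) (C \<inter> \<Gamma>') H" "C \<inter> \<Gamma>' \<subseteq> H"
      "subgroup K (Aut X)" "finite_index_in (Aut X) (C \<inter> \<Gamma>') K" "C \<inter> \<Gamma>' \<subseteq> K" "subgroup S (Aut X)"
    for H K S
  proof -
    obtain i where i: "0 < i" "i \<le> card (rcosets\<^bsub>Aut X\<lparr>carrier := H\<rparr>\<^esub> (C \<inter> \<Gamma>'))"
      "card (H \<inter> S) = i * card (C \<inter> \<Gamma>' \<inter> S)"
      using A.card_Int_eq_index_mult[OF HKS(1) CG HKS(7,3,2)] .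
    obtain j where j: "0 < j" "card (K \<inter> S) = j * card (C \<inter> \<Gamma>' \<inter> S)"
      using A.card_Int_eq_index_mult[OF HKS(4) CG HKS(7,6,5)] .
    have "w (card (H \<inter> S)) \<le> i * w (card (C \<inter> \<Gamma>' \<inter> S))" using w_mult i by simp
    also have "\<dots> \<le> i * w (card (K \<inter> S))" using w_mono j by simp
    finally show ?thesis using i(2) by (meson le_trans mult_le_mono1)
  qed
  have stab: "subgroup (stabilizer (Aut X) (\<lambda>g. g) z) (Aut X)" if "z \<in> pverts X" for z
    using act.stabilizer_subgroup[OF that] .
  have res: "stabilizer (Aut X\<lparr>carrier := H\<rparr>) (\<lambda>g. g) z = H \<inter> stabilizer (Aut X) (\<lambda>g. g) z"
    if "subgroup H (Aut X)" for H z
    by (rule stabilizer_restrict[OF subgroup.subset[OF that]])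
  have conj: "card (\<Gamma>.stab z) = card (C \<inter> stabilizer (Aut X) (\<lambda>g. g) (g z))" if "z \<in> pverts X" for z
    using act.card_stabilizer_conjugate[OF g subgroup.subset[OF sub(1)] that] res[OF C]
    by (simp add: C_def)
  have inv: "inv\<^bsub>Aut X\<^esub> g \<in> carrier (Aut X)" using g by simp
  note fin = fin[folded C_def]
  let ?m = "card (rcosets\<^bsub>Aut X\<lparr>carrier := C\<rparr>\<^esub> (C \<inter> \<Gamma>'))"
  let ?n = "card (rcosets\<^bsub>Aut X\<lparr>carrier := \<Gamma>'\<rparr>\<^esub> (C \<inter> \<Gamma>'))"
  have "w (card (\<Gamma>.stab z)) \<le> ?m * w (card (\<Gamma>'.stab (g z)))" if "z \<in> pverts X" for z
    using w_le[OF C fin(1) _ sub(2) fin(2) _ stab[OF Aut_closed[OF g that]]] conj[OF that] res[OF sub(2)]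
    by simp
  then have le: "growth_le (\<lambda>k. Max ((\<lambda>z. w (card (\<Gamma>.stab z))) ` graph_ball X x k))
      (\<lambda>k. Max ((\<lambda>z. w (card (\<Gamma>'.stab z))) ` graph_ball X y k))"
    by (rule growth_le_translate[OF g x(1) y(1)])
  \<comment> \<open>The reverse comparison translates by the inverse of \<open>g\<close>:
    \<open>conj\<close> at the vertex that \<open>g\<close> sends to \<open>z\<close> turns its
    \<open>\<Gamma>\<close>-stabilizer into the \<open>C\<close>-stabilizer of
    \<open>z\<close>.\<close>
  have "w (card (\<Gamma>'.stab z)) \<le> ?n * w (card (\<Gamma>.stab ((inv\<^bsub>Aut X\<^esub> g) z)))" if "z \<in> pverts X" for z
    using w_le[OF sub(2) fin(2) _ C fin(1) _ stab[OF that]] res[OF sub(2)]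
      conj[OF Aut_closed[OF inv that]] Aut_inv'[OF g that]
    by simp
  then have "growth_le (\<lambda>k. Max ((\<lambda>z. w (card (\<Gamma>'.stab z))) ` graph_ball X y k))
      (\<lambda>k. Max ((\<lambda>z. w (card (\<Gamma>.stab z))) ` graph_ball X x k))"
    by (rule growth_le_translate[OF inv y(1) x(1)])
  with le show ?thesis
    unfolding x(2) y(2) \<Gamma>.growth_eq_ball[OF x(1)] \<Gamma>'.growth_eq_ball[OF y(1)]
    by (rule growth_type_eqI)
qed

text \<open>For nonzero \<open>n\<close> the \<open>p\<close>-part is multiplicative, and the
  \<open>p\<close>-part of \<open>j\<close> lies between 1 and \<open>j\<close>.\<close>

lemma p_part_mult_bounds:
  fixes p j n :: nat
  assumes "prime p" "0 < j"
  shows "p ^ multiplicity p n \<le> p ^ multiplicity p (j * n)"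
    and "p ^ multiplicity p (j * n) \<le> j * p ^ multiplicity p n"
proof -
  have "p ^ multiplicity p (j * n) = p ^ multiplicity p j * p ^ multiplicity p n" if "n \<noteq> 0"
    using that assms by (simp add: prime_elem_multiplicity_mult_distrib power_add)
  moreover have "p ^ multiplicity p j \<le> j" "1 \<le> p ^ multiplicity p j"
    using assms by (auto intro: dvd_imp_le multiplicity_dvd simp: prime_gt_0_nat Suc_leI)
  \<comment> \<open>At \<open>n = 0\<close> multiplicativity can fail, but
    \<open>multiplicity p 0\<close> is 0, so both \<open>p\<close>-parts are 1 and the bounds reduce
    to 1 \<le> 1 and 1 \<le> \<open>j\<close>.\<close>
  ultimately show "p ^ multiplicity p n \<le> p ^ multiplicity p (j * n)"
    "p ^ multiplicity p (j * n) \<le> j * p ^ multiplicity p n"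
    using assms(2) by (cases "n = 0"; simp)+
qed

theorem corollary3p6:
  fixes X :: "'v pair_pre_digraph" and \<Gamma> \<Gamma>' :: "('v \<Rightarrow> 'v) set" and a a' :: "'v set"
  assumes "locally_finite_tree X"
    and "lattice_in (Aut X) (Aut_topology X) \<Gamma>"
    and "lattice_in (Aut X) (Aut_topology X) \<Gamma>'"
    and "commensurable (Aut X) \<Gamma> \<Gamma>'"
    and "without_inversions X \<Gamma>"
    and "without_inversions X \<Gamma>'"
    and "a \<in> verts (quotient_graph X \<Gamma>)"
    and "a' \<in> verts (quotient_graph X \<Gamma>')"
  shows "growth_type (stabilizer_growth X \<Gamma> a) = growth_type (stabilizer_growth X \<Gamma>' a') \<and>
    (\<forall>p::nat. prime p \<longrightarrow>
       growth_type (p_stabilizer_growth p X \<Gamma> a) = growth_type (p_stabilizer_growth p X \<Gamma>' a'))"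
proof -
  have "subgroup \<Gamma> (Aut X)" "subgroup \<Gamma>' (Aut X)"
    using assms(2,3) by (auto simp: lattice_in_def)
  note * = growth_type_commensurable[OF assms(1) this assms(4,7,8)]
  show ?thesis
  proof (intro conjI allI impI)
    show "growth_type (stabilizer_growth X \<Gamma> a) = growth_type (stabilizer_growth X \<Gamma>' a')"
      using *[of "\<lambda>n. n"] by (simp add: stabilizer_growth_def[abs_def])
    \<comment> \<open>Discharging the two conditions on \<open>w\<close> by
      \<open>p_part_mult_bounds\<close> instantiates \<open>w\<close> with the
      \<open>p\<close>-part.\<close>
    fix p :: nat assume "prime p"
    then show "growth_type (p_stabilizer_growth p X \<Gamma> a) = growth_type (p_stabilizer_growth p X \<Gamma>' a')"
      using *[OF p_part_mult_bounds, of p]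
      by (simp add: p_stabilizer_growth_def[abs_def] p_order_def)
  qed
qed

end
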